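(* Let $\mathcal{E}$ be a nonzero separable complex Hilbert space and let $S$ be the unilateral shift on $l^2_{\mathcal{E}}(\mathbb{N})$. For $T \in B(l^2_{\mathcal{E}}(\mathbb{N}))$ let $$R_{T} = \begin{pmatrix} S^* & T \\ 0 & S \end{pmatrix}$$ acting on $l^2_{\mathcal{E}}(\mathbb{N}) \oplus l^2_{\mathcal{E}}(\mathbb{N})$. Then for every $T \in B(l^2_{\mathcal{E}}(\mathbb{N}))$ and every integer $n \geq 1$, $$\left\| R_T^n \right\| \leq \frac{n\|T\| + \sqrt{n^2\|T\|^2 + 4}}{2}.$$ Moreover, this inequality is sharp in the sense that for each $n \geq 1$ there exists an operator $T \in B(l^2_{\mathcal{E}}(\mathbb{N}))$ for which equality is attained.
   Context: $l^2_{\mathcal{E}}(\mathbb{N})$ is the Hilbert space of square-summable sequences $(a_0,a_1,a_2,\ldots)$ with entries in $\mathcal{E}$, and $B(\mathcal{H})$ denotes the bounded linear operators on a Hilbert space $\mathcal{H}$, with $\|\cdot\|$ the operator norm. The unilateral shift $S$ on $l^2_{\mathcal{E}}(\mathbb{N})$ is $S(a_0,a_1,a_2,\ldots) = (0,a_0,a_1,\ldots)$. The operator $R_T$ is called a Foguel operator, and $R_T^n$ denotes its $n$-th power. *)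

theory Defs
  imports "HOL-Analysis.Analysis"
begin

(* The library has no complex inner product spaces.  The class below extends real_inner, so that
   norm, topology, bounded_linear and onorm are those of the library; the real inner product is the
   real part of the complex one, hence norm x is the square root of cinner x x.
   cinner is linear in its first argument. *)

class complex_inner = real_inner +
  fixes scaleC :: "complex \<Rightarrow> 'a \<Rightarrow> 'a"  (infixr \<open>*\<^sub>C\<close> 75)
    and cinner :: "'a \<Rightarrow> 'a \<Rightarrow> complex"
  assumes scaleC_add_right: "c *\<^sub>C (x + y) = c *\<^sub>C x + c *\<^sub>C y"
    and scaleC_add_left: "(c + d) *\<^sub>C x = c *\<^sub>C x + d *\<^sub>C x"
    and scaleC_scaleC: "c *\<^sub>C d *\<^sub>C x = (c * d) *\<^sub>C x"
    and scaleR_scaleC: "r *\<^sub>R x = complex_of_real r *\<^sub>C x"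
    and cinner_commute: "cinner x y = cnj (cinner y x)"
    and cinner_add_left: "cinner (x + y) z = cinner x z + cinner y z"
    and cinner_scaleC_left: "cinner (c *\<^sub>C x) y = c * cinner x y"
    and inner_eq_Re_cinner: "inner x y = Re (cinner x y)"

class complex_hilbert_space = complex_inner + complete_space

lemma cinner_self: "cinner x x = complex_of_real ((norm x)\<^sup>2)"
proof (rule complex_eqI)
  show "Re (cinner x x) = Re (complex_of_real ((norm x)\<^sup>2))"
    by (simp add: power2_norm_eq_inner inner_eq_Re_cinner)
  have "Im (cinner x x) = Im (cnj (cinner x x))"
    by (subst cinner_commute) simp
  then show "Im (cinner x x) = Im (complex_of_real ((norm x)\<^sup>2))" by simp
qed

lemma cinner_scaleC_right: "cinner x (c *\<^sub>C y) = cnj c * cinner x y"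
  by (metis cinner_commute cinner_scaleC_left complex_cnj_mult)

lemma cinner_add_right: "cinner x (y + z) = cinner x y + cinner x z"
  by (metis cinner_commute cinner_add_left complex_cnj_add)

lemma cinner_zero_left [simp]: "cinner 0 y = 0"
  using cinner_add_left[of 0 0 y] by simp

lemma cinner_zero_right [simp]: "cinner x 0 = 0"
  by (metis cinner_commute cinner_zero_left complex_cnj_zero)

lemma norm_scaleC: "norm (c *\<^sub>C x) = cmod c * norm x"
proof -
  have "complex_of_real ((norm (c *\<^sub>C x))\<^sup>2) = c * cnj c * cinner x x"
    by (simp only: cinner_self[symmetric] cinner_scaleC_left cinner_scaleC_right mult_ac)
  also have "\<dots> = complex_of_real ((cmod c * norm x)\<^sup>2)"
    by (simp only: cinner_self complex_norm_square[symmetric] power_mult_distrib of_real_mult)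
  finally have "(norm (c *\<^sub>C x))\<^sup>2 = (cmod c * norm x)\<^sup>2"
    using of_real_eq_iff by blast
  then show ?thesis by simp
qed

lemma cmod_cinner_le: "cmod (cinner x y) \<le> (norm x)\<^sup>2 + (norm y)\<^sup>2"
proof -
  have re: "\<bar>Re (cinner x y)\<bar> \<le> norm x * norm y"
    using Cauchy_Schwarz_ineq2[of x y] by (simp add: inner_eq_Re_cinner)
  have "Im (cinner x y) = inner ((- \<i>) *\<^sub>C x) y"
    by (simp add: inner_eq_Re_cinner cinner_scaleC_left)
  then have im: "\<bar>Im (cinner x y)\<bar> \<le> norm x * norm y"
    using Cauchy_Schwarz_ineq2[of "(- \<i>) *\<^sub>C x" y] by (simp add: norm_scaleC)
  have "cmod (cinner x y) \<le> 2 * (norm x * norm y)"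
    using cmod_le[of "cinner x y"] re im by linarith
  also have "\<dots> \<le> (norm x)\<^sup>2 + (norm y)\<^sup>2"
    using sum_squares_bound[of "norm x" "norm y"] by simp
  finally show ?thesis .
qed

instantiation complex :: complex_hilbert_space
begin

definition scaleC_complex :: "complex \<Rightarrow> complex \<Rightarrow> complex"
  where "scaleC_complex c x = c * x"

definition cinner_complex :: "complex \<Rightarrow> complex \<Rightarrow> complex"
  where "cinner_complex x y = x * cnj y"

instance
  by standard (auto simp: scaleC_complex_def cinner_complex_def algebra_simps inner_complex_def
      scaleR_conv_of_real)

end

instantiation prod :: (complex_inner, complex_inner) complex_inner
begin

definition scaleC_prod :: "complex \<Rightarrow> 'a \<times> 'b \<Rightarrow> 'a \<times> 'b"
  where "scaleC_prod c x = (c *\<^sub>C fst x, c *\<^sub>C snd x)"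

definition cinner_prod :: "'a \<times> 'b \<Rightarrow> 'a \<times> 'b \<Rightarrow> complex"
  where "cinner_prod x y = cinner (fst x) (fst y) + cinner (snd x) (snd y)"

instance
proof
  fix x y z :: "'a \<times> 'b" and c d :: complex and r :: real
  show "cinner x y = cnj (cinner y x)"
    unfolding cinner_prod_def complex_cnj_add by (metis cinner_commute)
qed (auto simp: scaleC_prod_def cinner_prod_def scaleC_add_right scaleC_add_left scaleC_scaleC
    scaleR_prod_def scaleR_scaleC cinner_add_left cinner_scaleC_left inner_eq_Re_cinner
    inner_prod_def algebra_simps)

end

instance prod :: (complex_hilbert_space, complex_hilbert_space) complex_hilbert_space ..

typedef (overloaded) 'e ell2 = "{a :: nat \<Rightarrow> 'e::complex_inner. summable (\<lambda>n. (norm (a n))\<^sup>2)}"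
  morphisms ell2_nth Ell2
  by (rule exI[of _ "\<lambda>_. 0"]) simp

setup_lifting type_definition_ell2

lemma summable_norm_sq_add:
  fixes a b :: "nat \<Rightarrow> 'e::complex_inner"
  assumes "summable (\<lambda>n. (norm (a n))\<^sup>2)" and "summable (\<lambda>n. (norm (b n))\<^sup>2)"
  shows "summable (\<lambda>n. (norm (a n + b n))\<^sup>2)"
proof (rule summable_comparison_test')
  show "summable (\<lambda>n. 2 * (norm (a n))\<^sup>2 + 2 * (norm (b n))\<^sup>2)"
    using assms by (intro summable_add summable_mult)
  show "norm ((norm (a n + b n))\<^sup>2) \<le> 2 * (norm (a n))\<^sup>2 + 2 * (norm (b n))\<^sup>2" for n
  proof -
    have "(norm (a n + b n))\<^sup>2 \<le> (norm (a n) + norm (b n))\<^sup>2"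
      by (intro power_mono norm_triangle_ineq norm_ge_zero)
    also have "\<dots> \<le> 2 * (norm (a n))\<^sup>2 + 2 * (norm (b n))\<^sup>2"
      using sum_squares_bound[of "norm (a n)" "norm (b n)"] by (simp add: power2_sum)
    finally show ?thesis by simp
  qed
qed

lemma summable_norm_sq_scaleC:
  fixes a :: "nat \<Rightarrow> 'e::complex_inner"
  assumes "summable (\<lambda>n. (norm (a n))\<^sup>2)"
  shows "summable (\<lambda>n. (norm (c *\<^sub>C a n))\<^sup>2)"
  using assms by (simp add: norm_scaleC power_mult_distrib summable_mult)

lemma summable_cinner_of_norm_sq:
  fixes a b :: "nat \<Rightarrow> 'e::complex_inner"
  assumes "summable (\<lambda>n. (norm (a n))\<^sup>2)" and "summable (\<lambda>n. (norm (b n))\<^sup>2)"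
  shows "summable (\<lambda>n. cinner (a n) (b n))"
  by (rule summable_comparison_test'[OF summable_add[OF assms]]) (rule cmod_cinner_le)

instantiation ell2 :: (complex_inner) complex_inner
begin

lift_definition zero_ell2 :: "'a ell2" is "\<lambda>_. 0"
  by simp

lift_definition plus_ell2 :: "'a ell2 \<Rightarrow> 'a ell2 \<Rightarrow> 'a ell2" is "\<lambda>a b n. a n + b n"
  by (simp add: summable_norm_sq_add)

lift_definition uminus_ell2 :: "'a ell2 \<Rightarrow> 'a ell2" is "\<lambda>a n. - a n"
  by simp

lift_definition minus_ell2 :: "'a ell2 \<Rightarrow> 'a ell2 \<Rightarrow> 'a ell2" is "\<lambda>a b n. a n - b n"
  subgoal for a b using summable_norm_sq_add[of a "\<lambda>n. - b n"] by simp
  done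

lift_definition scaleC_ell2 :: "complex \<Rightarrow> 'a ell2 \<Rightarrow> 'a ell2" is "\<lambda>c a n. c *\<^sub>C a n"
  by (simp add: summable_norm_sq_scaleC)

definition scaleR_ell2 :: "real \<Rightarrow> 'a ell2 \<Rightarrow> 'a ell2"
  where "scaleR_ell2 r a = complex_of_real r *\<^sub>C a"

definition cinner_ell2 :: "'a ell2 \<Rightarrow> 'a ell2 \<Rightarrow> complex"
  where "cinner_ell2 a b = (\<Sum>n. cinner (ell2_nth a n) (ell2_nth b n))"

definition inner_ell2 :: "'a ell2 \<Rightarrow> 'a ell2 \<Rightarrow> real"
  where "inner_ell2 a b = Re (cinner a b)"

definition norm_ell2 :: "'a ell2 \<Rightarrow> real"
  where "norm_ell2 a = sqrt (\<Sum>n. (norm (ell2_nth a n))\<^sup>2)"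

definition sgn_ell2 :: "'a ell2 \<Rightarrow> 'a ell2"
  where "sgn_ell2 a = inverse (norm a) *\<^sub>R a"

definition dist_ell2 :: "'a ell2 \<Rightarrow> 'a ell2 \<Rightarrow> real"
  where "dist_ell2 a b = norm (a - b)"

definition uniformity_ell2 :: "('a ell2 \<times> 'a ell2) filter"
  where "uniformity_ell2 = (INF e\<in>{0<..}. principal {(a, b). dist a b < e})"

definition open_ell2 :: "'a ell2 set \<Rightarrow> bool"
  where "open_ell2 U \<longleftrightarrow> (\<forall>a\<in>U. \<forall>\<^sub>F (a', b) in uniformity. a' = a \<longrightarrow> b \<in> U)"

instance
proof
  fix a b c :: "'a ell2" and r s :: real and z w :: complex and U :: "'a ell2 set"
  note summ = ell2_nth[simplified, of a] ell2_nth[simplified, of b] ell2_nth[simplified, of c]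
  have csumm: "summable (\<lambda>n. cinner (ell2_nth a n) (ell2_nth b n))" for a b :: "'a ell2"
    by (intro summable_cinner_of_norm_sq ell2_nth[simplified])
  show "a + b + c = a + (b + c)" by transfer (simp add: add.assoc)
  show "a + b = b + a" by transfer (simp add: add.commute)
  show "0 + a = a" by transfer simp
  show "- a + a = 0" by transfer simp
  show "a - b = a + - b" by transfer simp
  show C1: "z *\<^sub>C (a + b) = z *\<^sub>C a + z *\<^sub>C b" for z and a b :: "'a ell2"
    by transfer (simp add: scaleC_add_right)
  show C2: "(z + w) *\<^sub>C a = z *\<^sub>C a + w *\<^sub>C a" for z w and a :: "'a ell2"
    by transfer (simp add: scaleC_add_left)
  show C3: "z *\<^sub>C w *\<^sub>C a = (z * w) *\<^sub>C a" for z w and a :: "'a ell2"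
    by transfer (simp add: scaleC_scaleC)
  show "r *\<^sub>R (a + b) = r *\<^sub>R a + r *\<^sub>R b" by (simp add: scaleR_ell2_def C1)
  show "(r + s) *\<^sub>R a = r *\<^sub>R a + s *\<^sub>R a" by (simp add: scaleR_ell2_def C2)
  show "r *\<^sub>R s *\<^sub>R a = (r * s) *\<^sub>R a" by (simp add: scaleR_ell2_def C3)
  show "1 *\<^sub>R a = a"
    unfolding scaleR_ell2_def by transfer (simp add: scaleR_scaleC[symmetric] del: of_real_1)
  show "r *\<^sub>R a = complex_of_real r *\<^sub>C a" by (rule scaleR_ell2_def)
  show "sgn a = inverse (norm a) *\<^sub>R a" by (rule sgn_ell2_def)
  show "dist a b = norm (a - b)" by (rule dist_ell2_def)
  show "(uniformity :: ('a ell2 \<times> 'a ell2) filter)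
      = (INF e\<in>{0<..}. principal {(a, b). dist a b < e})"
    by (rule uniformity_ell2_def)
  show "open U = (\<forall>a\<in>U. \<forall>\<^sub>F (a', b) in uniformity. a' = a \<longrightarrow> b \<in> U)"
    by (rule open_ell2_def)
  show comm: "cinner a b = cnj (cinner b a)" for a b :: "'a ell2"
  proof -
    have "cnj (cinner b a) = (\<Sum>n. cnj (cinner (ell2_nth b n) (ell2_nth a n)))"
      unfolding cinner_ell2_def
      by (rule sums_unique) (simp add: sums_cnj summable_sums csumm)
    also have "\<dots> = cinner a b"
      by (simp add: cinner_ell2_def cinner_commute[symmetric])
    finally show ?thesis by simp
  qed
  show cadd: "cinner (a + b) c = cinner a c + cinner b c" for a b c :: "'a ell2"
    unfolding cinner_ell2_def
    by (simp add: plus_ell2.rep_eq cinner_add_left suminf_add[OF csumm csumm, symmetric])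
  show cscale: "cinner (z *\<^sub>C a) b = z * cinner a b" for z and a b :: "'a ell2"
    unfolding cinner_ell2_def
    by (simp add: scaleC_ell2.rep_eq cinner_scaleC_left suminf_mult[OF csumm])
  show "inner a b = Re (cinner a b)" by (rule inner_ell2_def)
  show "inner a b = inner b a" by (simp add: inner_ell2_def comm[of a b])
  show "inner (a + b) c = inner a c + inner b c" by (simp add: inner_ell2_def cadd)
  show "inner (r *\<^sub>R a) b = r * inner a b"
    by (simp add: inner_ell2_def scaleR_ell2_def cscale)
  have self: "inner a a = (\<Sum>n. (norm (ell2_nth a n))\<^sup>2)"
    unfolding inner_ell2_def cinner_ell2_def cinner_self
    using suminf_of_real[OF summ(1), where 'a = complex] by (metis Re_complex_of_real)
  show "0 \<le> inner a a" unfolding self by (intro suminf_nonneg summ) simp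
  show "inner a a = 0 \<longleftrightarrow> a = 0"
    unfolding self using suminf_eq_zero_iff[OF summ(1)]
    by (auto simp: ell2_nth_inject[symmetric] zero_ell2.rep_eq fun_eq_iff)
  show "norm a = sqrt (inner a a)" unfolding self by (rule norm_ell2_def)
qed

end

lemma sum_le_norm_ell2: "(\<Sum>n<N. (norm (ell2_nth a n))\<^sup>2) \<le> (norm a)\<^sup>2"
proof -
  have s: "summable (\<lambda>n. (norm (ell2_nth a n))\<^sup>2)" using ell2_nth[of a] by simp
  show ?thesis unfolding norm_ell2_def
    using sum_le_suminf[OF s, of "{..<N}"] suminf_nonneg[OF s] by simp
qed

lemma norm_ell2_nth_le: "norm (ell2_nth a n) \<le> norm a"
proof (rule power2_le_imp_le)
  have "(norm (ell2_nth a n))\<^sup>2 \<le> (\<Sum>k<Suc n. (norm (ell2_nth a k))\<^sup>2)"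
    by (simp add: sum_nonneg)
  also have "\<dots> \<le> (norm a)\<^sup>2" by (rule sum_le_norm_ell2)
  finally show "(norm (ell2_nth a n))\<^sup>2 \<le> (norm a)\<^sup>2" .
qed simp

instance ell2 :: (complex_hilbert_space) complex_hilbert_space
proof
  fix X :: "nat \<Rightarrow> 'a ell2" assume X: "Cauchy X"
  have "Cauchy (\<lambda>i. ell2_nth (X i) n)" for n
  proof (rule metric_CauchyI)
    fix e :: real assume "e > 0"
    then obtain M where M: "\<And>i j. i \<ge> M \<Longrightarrow> j \<ge> M \<Longrightarrow> dist (X i) (X j) < e"
      using metric_CauchyD[OF X] by blast
    have "dist (ell2_nth (X i) n) (ell2_nth (X j) n) < e" if "i \<ge> M" "j \<ge> M" for i j
      using norm_ell2_nth_le[of "X i - X j" n] M[OF that]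
      by (simp add: dist_norm minus_ell2.rep_eq)
    then show "\<exists>M. \<forall>i\<ge>M. \<forall>j\<ge>M. dist (ell2_nth (X i) n) (ell2_nth (X j) n) < e" by blast
  qed
  then have "\<exists>L. (\<lambda>i. ell2_nth (X i) n) \<longlonglongrightarrow> L" for n
    using Cauchy_convergent_iff convergent_def by blast
  then obtain L where L: "\<And>n. (\<lambda>i. ell2_nth (X i) n) \<longlonglongrightarrow> L n" by metis
  have key: "\<exists>M. \<forall>i\<ge>M. \<forall>N. (\<Sum>n<N. (norm (ell2_nth (X i) n - L n))\<^sup>2) \<le> e\<^sup>2" if "e > 0" for e
  proof -
    obtain M where M: "\<And>i j. i \<ge> M \<Longrightarrow> j \<ge> M \<Longrightarrow> dist (X i) (X j) < e"
      using metric_CauchyD[OF X \<open>e > 0\<close>] by blast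
    have "(\<Sum>n<N. (norm (ell2_nth (X i) n - L n))\<^sup>2) \<le> e\<^sup>2" if "i \<ge> M" for i N
    proof (rule LIMSEQ_le_const2)
      show "(\<lambda>j. \<Sum>n<N. (norm (ell2_nth (X i) n - ell2_nth (X j) n))\<^sup>2)
          \<longlonglongrightarrow> (\<Sum>n<N. (norm (ell2_nth (X i) n - L n))\<^sup>2)"
        by (intro tendsto_intros L)
      have "(\<Sum>n<N. (norm (ell2_nth (X i) n - ell2_nth (X j) n))\<^sup>2) \<le> e\<^sup>2" if "j \<ge> M" for j
      proof -
        have "(\<Sum>n<N. (norm (ell2_nth (X i) n - ell2_nth (X j) n))\<^sup>2) \<le> (norm (X i - X j))\<^sup>2"
          using sum_le_norm_ell2[of "X i - X j" N] by (simp add: minus_ell2.rep_eq)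
        also have "\<dots> \<le> e\<^sup>2"
          using M[OF \<open>i \<ge> M\<close> that] by (intro power_mono) (auto simp: dist_norm)
        finally show ?thesis .
      qed
      then show "\<exists>M. \<forall>j\<ge>M. (\<Sum>n<N. (norm (ell2_nth (X i) n - ell2_nth (X j) n))\<^sup>2) \<le> e\<^sup>2"
        by blast
    qed
    then show ?thesis by blast
  qed
  have summ: "summable (\<lambda>n. (norm (f n))\<^sup>2)"
    if "\<And>N. (\<Sum>n<N. (norm (f n))\<^sup>2) \<le> B" for f :: "nat \<Rightarrow> 'a" and B
    using that by (intro bounded_imp_summable[where B = B])
      (simp_all only: lessThan_Suc_atMost[symmetric] zero_le_power2)
  obtain M where M: "\<And>i N. i \<ge> M \<Longrightarrow> (\<Sum>n<N. (norm (ell2_nth (X i) n - L n))\<^sup>2) \<le> 1\<^sup>2"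
    using key[of 1] by auto
  have "summable (\<lambda>n. (norm (ell2_nth (X M) n - L n))\<^sup>2)"
    using M[of M] by (intro summ) blast
  then have "summable (\<lambda>n. (norm (L n - ell2_nth (X M) n))\<^sup>2)"
    by (simp add: norm_minus_commute)
  from summable_norm_sq_add[OF this ell2_nth[of "X M", simplified]]
  have "summable (\<lambda>n. (norm (L n))\<^sup>2)" by simp
  then have nth: "ell2_nth (Ell2 L) = L" by (simp add: Ell2_inverse)
  have "X \<longlonglongrightarrow> Ell2 L"
  proof (rule metric_LIMSEQ_I)
    fix e :: real assume "e > 0"
    then obtain M where M: "\<And>i N. i \<ge> M \<Longrightarrow> (\<Sum>n<N. (norm (ell2_nth (X i) n - L n))\<^sup>2) \<le> (e/2)\<^sup>2"
      using key[of "e/2"] by auto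
    have "dist (X i) (Ell2 L) < e" if "i \<ge> M" for i
    proof -
      have "dist (X i) (Ell2 L) = sqrt (\<Sum>n. (norm (ell2_nth (X i) n - L n))\<^sup>2)"
        by (simp add: dist_norm norm_ell2_def minus_ell2.rep_eq nth)
      also have "\<dots> \<le> sqrt ((e/2)\<^sup>2)"
        using M[OF that] by (intro real_sqrt_le_mono suminf_le_const summ) auto
      also have "\<dots> < e" using \<open>e > 0\<close> by simp
      finally show ?thesis .
    qed
    then show "\<exists>M. \<forall>i\<ge>M. dist (X i) (Ell2 L) < e" by blast
  qed
  then show "convergent X" by (rule convergentI)
qed

locale bounded_clinear = bounded_linear f
  for f :: "'a::complex_inner \<Rightarrow> 'b::complex_inner" +
  assumes scaleC: "f (c *\<^sub>C x) = c *\<^sub>C f x"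

(* Hilbert space adjoint; it is unique whenever it exists, and exists in particular for every
   bounded operator between Hilbert spaces. *)
definition cadjoint :: "('a::complex_inner \<Rightarrow> 'b::complex_inner) \<Rightarrow> 'b \<Rightarrow> 'a"
  where "cadjoint A = (THE B. \<forall>x y. cinner (A x) y = cinner x (B y))"

lemma cadjoint_eqI:
  assumes AB: "\<And>x y. cinner (A x) y = cinner x (B y)"
  shows "cadjoint A = B"
  unfolding cadjoint_def
proof (rule the_equality)
  fix C assume C: "\<forall>x y. cinner (A x) y = cinner x (C y)"
  show "C = B"
  proof
    fix y
    have "inner x (C y) = inner x (B y)" for x
      using AB C by (simp add: inner_eq_Re_cinner)
    then have "inner (C y - B y) (C y - B y) = 0" by (simp only: inner_diff_right)
    then show "C y = B y" by simp
  qed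
qed (use AB in blast)

lift_definition shift :: "'e::complex_inner ell2 \<Rightarrow> 'e ell2"
  is "\<lambda>a n. case n of 0 \<Rightarrow> 0 | Suc m \<Rightarrow> a m"
  by (subst summable_Suc_iff[symmetric]) simp

lift_definition backward_shift :: "'e::complex_inner ell2 \<Rightarrow> 'e ell2"
  is "\<lambda>a n. a (Suc n)"
  by (subst (asm) summable_Suc_iff[symmetric]) simp

lemma cadjoint_shift: "cadjoint (shift :: 'e::complex_inner ell2 \<Rightarrow> 'e ell2) = backward_shift"
proof (rule cadjoint_eqI)
  fix a b :: "'e ell2"
  have "summable (\<lambda>n. cinner (ell2_nth (shift a) n) (ell2_nth b n))"
    by (intro summable_cinner_of_norm_sq ell2_nth[simplified])
  from suminf_split_head[OF this] show "cinner (shift a) b = cinner a (backward_shift b)"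
    by (simp add: cinner_ell2_def shift.rep_eq backward_shift.rep_eq)
qed

(* The operator matrix with rows (S*, T) and (0, S), acting on column vectors (x, y); the product
   type carries the Hilbert space direct sum norm. *)
definition foguel :: "('e::complex_hilbert_space ell2 \<Rightarrow> 'e ell2)
    \<Rightarrow> 'e ell2 \<times> 'e ell2 \<Rightarrow> 'e ell2 \<times> 'e ell2"
  where "foguel T = (\<lambda>(x, y). (cadjoint shift x + T y, shift y))"

end

theory Submission
  imports Defs
begin

text \<open>The power \<open>R\<^sub>T\<^sup>n\<close> has diagonal \<open>S\<^sup>*\<^sup>n\<close>, \<open>S\<^sup>n\<close> and corner
  \<open>\<Sum>i<n. S\<^sup>*\<^sup>i T S\<^sup>n\<^sup>-\<^sup>1\<^sup>-\<^sup>i\<close>, whose norm is at most \<open>s = n\<parallel>T\<parallel>\<close>. Hence \<open>\<parallel>R\<^sub>T\<^sup>n\<parallel>\<close> is at most the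
  norm \<open>M\<close> of the matrix with rows \<open>(1, s)\<close> and \<open>(0, 1)\<close>, which is the positive root of
  \<open>M\<^sup>2 = s M + 1\<close>. For \<open>T\<close> the flip \<open>e\<^sub>j \<mapsto> e\<^sub>n\<^sub>-\<^sub>1\<^sub>-\<^sub>j\<close>, \<open>j < n\<close>, all summands of the
  corner send \<open>e\<^sub>0\<close> to the same vector, and \<open>(e\<^sub>n, M e\<^sub>0)\<close> is a maximizing vector.\<close>

section \<open>Norms and real linearity of the shifts and of \<open>foguel T\<close>\<close>

lemma norm_ell2_sq: "(norm a)\<^sup>2 = (\<Sum>n. (norm (ell2_nth a n))\<^sup>2)"
  unfolding norm_ell2_def using ell2_nth[of a] by (simp add: suminf_nonneg)

lemma norm_shift [simp]: "norm (shift a) = norm a"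
proof -
  have "summable (\<lambda>n. (norm (ell2_nth (shift a) n))\<^sup>2)"
    using ell2_nth[of "shift a"] by simp
  from suminf_split_head[OF this] show ?thesis
    by (simp add: norm_ell2_def shift.rep_eq)
qed

lemma norm_backward_shift_le: "norm (backward_shift a) \<le> norm a"
proof -
  have "summable (\<lambda>n. (norm (ell2_nth a n))\<^sup>2)"
    using ell2_nth[of a] by simp
  from suminf_split_head[OF this] show ?thesis
    by (simp add: norm_ell2_def backward_shift.rep_eq)
qed

lemma norm_shift_funpow [simp]: "norm ((shift ^^ n) a) = norm a"
  by (induction n) simp_all

lemma norm_backward_shift_funpow_le: "norm ((backward_shift ^^ n) a) \<le> norm a"
  by (induction n) (auto intro: order_trans[OF norm_backward_shift_le])

lemma scaleR_ell2_nth: "ell2_nth (r *\<^sub>R a) n = r *\<^sub>R ell2_nth a n"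
  by (simp add: scaleR_scaleC scaleC_ell2.rep_eq)

lemma bounded_linear_shift: "bounded_linear shift"
  by (rule bounded_linear_intro[where K = 1])
    (auto simp: ell2_nth_inject[symmetric] shift.rep_eq plus_ell2.rep_eq scaleR_ell2_nth
      fun_eq_iff split: nat.split)

lemma bounded_linear_backward_shift: "bounded_linear backward_shift"
  by (rule bounded_linear_intro[where K = 1])
    (auto simp: ell2_nth_inject[symmetric] backward_shift.rep_eq plus_ell2.rep_eq scaleR_ell2_nth
      norm_backward_shift_le)

lemma bounded_linear_funpow:
  fixes f :: "'a::real_normed_vector \<Rightarrow> 'a"
  assumes "bounded_linear f"
  shows "bounded_linear (f ^^ n)"
proof (induction n)
  case 0
  show ?case by (simp add: id_def bounded_linear_ident)
next
  case (Suc n)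
  then show ?case using bounded_linear_compose[OF assms Suc] by (simp add: comp_def)
qed

lemma bounded_linear_foguel:
  assumes "bounded_linear T"
  shows "bounded_linear (foguel T)"
  unfolding foguel_def cadjoint_shift case_prod_beta
  by (intro bounded_linear_Pair bounded_linear_add
      bounded_linear_compose[OF bounded_linear_backward_shift] bounded_linear_compose[OF assms]
      bounded_linear_compose[OF bounded_linear_shift] bounded_linear_fst bounded_linear_snd)

section \<open>Powers of the operator matrix\<close>

lemma foguel_funpow:
  "(foguel T ^^ n) (x, y) =
    ((backward_shift ^^ n) x + (\<Sum>i<n. (backward_shift ^^ i) (T ((shift ^^ (n - 1 - i)) y))),
     (shift ^^ n) y)"
proof (induction n)
  case 0
  show ?case by simp
next
  case (Suc n)
  interpret B: bounded_linear backward_shift by (rule bounded_linear_backward_shift)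
  have step: "foguel T (u, v) = (backward_shift u + T v, shift v)" for u v
    by (simp add: foguel_def cadjoint_shift)
  \<comment> \<open>One more factor on the left applies \<open>backward_shift\<close> to every old
    summand, raising its index \<open>i\<close> by one, and adds \<open>T ((shift ^^ n) y)\<close>.
    This is the new summand at index 0, so the sum is split at its head.\<close>
  show ?case
    by (simp add: Suc step B.add B.sum sum.lessThan_Suc_shift algebra_simps
        del: sum.lessThan_Suc)
qed

section \<open>The scalar estimate and the upper bound\<close>

lemma foguel_bound_root:
  fixes s :: real
  defines "M \<equiv> (s + sqrt (s\<^sup>2 + 4)) / 2"
  shows "M\<^sup>2 = s * M + 1"
  by (simp add: M_def power2_sum power_divide field_simps) (simp add: power2_eq_square)

lemma foguel_bound_pos: "(s + sqrt (s\<^sup>2 + 4)) / 2 > (0::real)"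
proof -
  have "\<bar>s\<bar> < sqrt (s\<^sup>2 + 4)" by (rule real_less_rsqrt) simp
  then show ?thesis by simp
qed

text \<open>Since \<open>M\<^sup>2 = s * M + 1\<close>, the difference of the two sides times
  \<open>M\<close> is \<open>s * (M * a - b)\<^sup>2\<close>. Equality therefore holds when
  \<open>b = M * a\<close>, which dictates the ratio of norms in the maximizing vector.\<close>

lemma unipotent_matrix_bound:
  fixes s a b :: real
  defines "M \<equiv> (s + sqrt (s\<^sup>2 + 4)) / 2"
  assumes "s \<ge> 0"
  shows "(a + s * b)\<^sup>2 + b\<^sup>2 \<le> M\<^sup>2 * (a\<^sup>2 + b\<^sup>2)"
proof -
  have M: "M > 0" "M * M = s * M + 1"
    using foguel_bound_pos[of s] foguel_bound_root[of s] by (simp_all add: M_def power2_eq_square)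
  have "M * (M\<^sup>2 * (a\<^sup>2 + b\<^sup>2) - ((a + s * b)\<^sup>2 + b\<^sup>2)) = s * (M * a - b)\<^sup>2"
    using M(2) by algebra
  then have "0 \<le> M * (M\<^sup>2 * (a\<^sup>2 + b\<^sup>2) - ((a + s * b)\<^sup>2 + b\<^sup>2))"
    using \<open>s \<ge> 0\<close> by simp
  then show ?thesis using M(1) by (simp add: zero_le_mult_iff)
qed

lemma onorm_foguel_funpow_le:
  fixes T :: "'e::complex_hilbert_space ell2 \<Rightarrow> 'e ell2" and n :: nat
  assumes T: "bounded_linear T"
  defines "s \<equiv> real n * onorm T"
  shows "onorm (foguel T ^^ n) \<le> (s + sqrt (s\<^sup>2 + 4)) / 2"
proof (rule onorm_bound)
  let ?M = "(s + sqrt (s\<^sup>2 + 4)) / 2"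
  show "0 \<le> ?M" using foguel_bound_pos less_imp_le by blast
  have s0: "s \<ge> 0" using onorm_pos_le[OF T] by (simp add: s_def)
  fix z :: "'e ell2 \<times> 'e ell2"
  obtain x y where z: "z = (x, y)" by (cases z)
  define w where "w = (\<Sum>i<n. (backward_shift ^^ i) (T ((shift ^^ (n - 1 - i)) y)))"
  \<comment> \<open>\<open>shift\<close> is an isometry and \<open>backward_shift\<close> a
    contraction, so each of the \<open>n\<close> summands costs at most one factor
    \<open>onorm T\<close>.\<close>
  have "norm w \<le> (\<Sum>i<n. onorm T * norm y)"
    unfolding w_def
  proof (rule sum_norm_le)
    fix i
    show "norm ((backward_shift ^^ i) (T ((shift ^^ (n - 1 - i)) y))) \<le> onorm T * norm y"
      using norm_backward_shift_funpow_le onorm[OF T, of "(shift ^^ (n - 1 - i)) y"]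
      by (auto intro: order_trans)
  qed
  then have "norm ((backward_shift ^^ n) x + w) \<le> norm x + s * norm y"
    using norm_backward_shift_funpow_le[of n x] norm_triangle_ineq[of "(backward_shift ^^ n) x" w]
    by (simp add: s_def)
  \<comment> \<open>The second component has norm exactly \<open>norm y\<close>, so only the pair of
    numbers \<open>norm x\<close>, \<open>norm y\<close> matters from here on.\<close>
  then have "(norm ((foguel T ^^ n) z))\<^sup>2 \<le> (norm x + s * norm y)\<^sup>2 + (norm y)\<^sup>2"
    unfolding z foguel_funpow w_def[symmetric] norm_Pair by (simp add: power_mono)
  also have "\<dots> \<le> ?M\<^sup>2 * ((norm x)\<^sup>2 + (norm y)\<^sup>2)"
    by (rule unipotent_matrix_bound[OF s0])
  also have "\<dots> = (?M * norm z)\<^sup>2"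
    unfolding power_mult_distrib z norm_Pair by simp
  finally show "norm ((foguel T ^^ n) z) \<le> ?M * norm z"
    by (rule power2_le_imp_le) (use \<open>0 \<le> ?M\<close> in simp)
qed

section \<open>Sharpness: basis vectors and the flip\<close>

lift_definition single_ell2 :: "nat \<Rightarrow> 'e::complex_inner \<Rightarrow> 'e ell2"
  is "\<lambda>k v n. if n = k then v else 0"
  by (rule summable_finite[of "{_}"]) auto

lemma norm_single_ell2 [simp]: "norm (single_ell2 k v) = norm v"
proof -
  have "(\<Sum>n. (norm (ell2_nth (single_ell2 k v) n))\<^sup>2) = (norm v)\<^sup>2"
    by (subst suminf_finite[of "{k}"]) (auto simp: single_ell2.rep_eq)
  then show ?thesis by (simp add: norm_ell2_def)
qed

lemma shift_single_ell2: "shift (single_ell2 k v) = single_ell2 (Suc k) v"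
  by (auto simp: ell2_nth_inject[symmetric] shift.rep_eq single_ell2.rep_eq fun_eq_iff
      split: nat.split)

lemma backward_shift_single_ell2: "backward_shift (single_ell2 (Suc k) v) = single_ell2 k v"
  by (auto simp: ell2_nth_inject[symmetric] backward_shift.rep_eq single_ell2.rep_eq)

lemma shift_funpow_single_ell2: "(shift ^^ n) (single_ell2 0 v) = single_ell2 n v"
  by (induction n) (simp_all add: shift_single_ell2)

lemma backward_shift_funpow_single_ell2:
  "(backward_shift ^^ n) (single_ell2 n v) = single_ell2 0 v"
  by (induction n) (simp_all add: backward_shift_single_ell2 funpow_Suc_right del: funpow.simps)

text \<open>Chosen so that the triangle inequality for the corner is an equality at e_0: for
  \<open>i < n\<close>, the shifts move e_0 to index \<open>n - 1 - i\<close>, the flip sends this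
  to index \<open>i\<close>, and \<open>i\<close> backward shifts return it to e_0.\<close>

lift_definition flip_ell2 :: "nat \<Rightarrow> 'e::complex_inner ell2 \<Rightarrow> 'e ell2"
  is "\<lambda>n a m. if m < n then a (n - 1 - m) else 0"
  by (rule summable_finite[of "{..<_}"]) auto

lemma norm_flip_ell2_le: "norm (flip_ell2 n a) \<le> norm a"
proof (rule power2_le_imp_le)
  have "(norm (flip_ell2 n a))\<^sup>2 = (\<Sum>m<n. (norm (ell2_nth a (n - Suc m)))\<^sup>2)"
    unfolding norm_ell2_sq by (subst suminf_finite[of "{..<n}"]) (auto simp: flip_ell2.rep_eq)
  also have "\<dots> = (\<Sum>m<n. (norm (ell2_nth a m))\<^sup>2)"
    by (rule sum.nat_diff_reindex)
  also have "\<dots> \<le> (norm a)\<^sup>2" by (rule sum_le_norm_ell2)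
  finally show "(norm (flip_ell2 n a))\<^sup>2 \<le> (norm a)\<^sup>2" .
qed simp

lemma flip_single_ell2: "k < n \<Longrightarrow> flip_ell2 n (single_ell2 k v) = single_ell2 (n - 1 - k) v"
  by (auto simp: ell2_nth_inject[symmetric] flip_ell2.rep_eq single_ell2.rep_eq fun_eq_iff)

lemma scaleC_zero_right [simp]: "c *\<^sub>C 0 = 0"
  using norm_scaleC[of c 0] by simp

lemma bounded_clinear_flip_ell2: "bounded_clinear (flip_ell2 n)"
proof (intro bounded_clinear.intro bounded_clinear_axioms.intro)
  show "bounded_linear (flip_ell2 n :: 'a ell2 \<Rightarrow> 'a ell2)"
    by (rule bounded_linear_intro[where K = 1])
      (auto simp: ell2_nth_inject[symmetric] flip_ell2.rep_eq plus_ell2.rep_eq scaleR_ell2_nth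
        fun_eq_iff norm_flip_ell2_le)
  show "flip_ell2 n (c *\<^sub>C x) = c *\<^sub>C flip_ell2 n x" for c and x :: "'a ell2"
    by (auto simp: ell2_nth_inject[symmetric] flip_ell2.rep_eq scaleC_ell2.rep_eq fun_eq_iff)
qed

lemma onorm_flip_ell2:
  assumes "\<exists>v :: 'e::complex_inner. v \<noteq> 0" and "n \<ge> 1"
  shows "onorm (flip_ell2 n :: 'e ell2 \<Rightarrow> 'e ell2) = 1"
proof (rule antisym)
  show "onorm (flip_ell2 n :: 'e ell2 \<Rightarrow> 'e ell2) \<le> 1"
    by (rule onorm_bound) (simp_all add: norm_flip_ell2_le)
  obtain v :: 'e where "v \<noteq> 0" using assms(1) by blast
  have "bounded_linear (flip_ell2 n :: 'e ell2 \<Rightarrow> 'e ell2)"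
    using bounded_clinear_flip_ell2 by (rule bounded_clinear.axioms)
  \<comment> \<open>For \<open>n \<ge> 1\<close> the flip moves index 0 to \<open>n - 1\<close> and
    keeps the norm; for \<open>n = 0\<close> it would be the zero operator.\<close>
  from le_onorm[OF this, of "single_ell2 0 v"]
  show "1 \<le> onorm (flip_ell2 n :: 'e ell2 \<Rightarrow> 'e ell2)"
    using \<open>v \<noteq> 0\<close> \<open>n \<ge> 1\<close> by (simp add: flip_single_ell2)
qed

lemma scaleR_single_ell2: "r *\<^sub>R single_ell2 k v = single_ell2 k (r *\<^sub>R v)"
  by (auto simp: ell2_nth_inject[symmetric] scaleR_ell2_nth single_ell2.rep_eq fun_eq_iff)

lemma add_single_ell2: "single_ell2 k v + single_ell2 k w = single_ell2 k (v + w)"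
  by (auto simp: ell2_nth_inject[symmetric] plus_ell2.rep_eq single_ell2.rep_eq fun_eq_iff)

lemma onorm_foguel_flip_funpow:
  assumes nonzero: "\<exists>v :: 'e::complex_hilbert_space. v \<noteq> 0" and n: "n \<ge> 1"
  defines "s \<equiv> real n"
  shows "onorm (foguel (flip_ell2 n :: 'e ell2 \<Rightarrow> 'e ell2) ^^ n) = (s + sqrt (s\<^sup>2 + 4)) / 2"
proof (rule antisym)
  let ?T = "flip_ell2 n :: 'e ell2 \<Rightarrow> 'e ell2"
  define M where "M = (s + sqrt (s\<^sup>2 + 4)) / 2"
  have T: "bounded_linear ?T"
    using bounded_clinear_flip_ell2 by (rule bounded_clinear.axioms)
  show "onorm (foguel ?T ^^ n) \<le> (s + sqrt (s\<^sup>2 + 4)) / 2"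
    using onorm_foguel_funpow_le[OF T, of n] by (simp add: onorm_flip_ell2[OF nonzero n] s_def)
  obtain v :: 'e where v: "v \<noteq> 0" using nonzero by blast
  \<comment> \<open>The index \<open>n\<close> of \<open>x\<close> makes \<open>n\<close> backward
    shifts land at index 0, aligned with the corner applied to \<open>y\<close>. The factor
    \<open>M\<close> gives \<open>norm y = M * norm x\<close>, the equality case of the scalar
    estimate.\<close>
  define x y where "x = single_ell2 n v" and "y = single_ell2 0 (M *\<^sub>R v)"
  have M: "M > 0" "M\<^sup>2 = s * M + 1"
    unfolding M_def by (fact foguel_bound_pos foguel_bound_root)+
  have "(backward_shift ^^ i) (?T ((shift ^^ (n - 1 - i)) y)) = y" if "i < n" for i
    using that
    by (simp add: y_def shift_funpow_single_ell2 flip_single_ell2 backward_shift_funpow_single_ell2)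
  then have "(foguel ?T ^^ n) (x, y) = (single_ell2 0 v + (\<Sum>i<n. y), (shift ^^ n) y)"
    by (simp add: foguel_funpow x_def backward_shift_funpow_single_ell2)
  \<comment> \<open>The coefficients at index 0 add up to \<open>1 + s * M\<close>, which is
    \<open>M\<^sup>2\<close>.\<close>
  also have "\<dots> = (single_ell2 0 (M\<^sup>2 *\<^sub>R v), (shift ^^ n) y)"
    by (simp add: y_def sum_constant_scaleR scaleR_single_ell2 add_single_ell2 M(2) s_def
        algebra_simps)
  finally have "(norm ((foguel ?T ^^ n) (x, y)))\<^sup>2 = (M\<^sup>2 * norm v)\<^sup>2 + (M * norm v)\<^sup>2"
    using M(1) by (simp add: norm_Pair y_def)
  \<comment> \<open>Both sides equal
    \<open>M\<^sup>2 * (1 + M\<^sup>2) * (norm v)\<^sup>2\<close>.\<close>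
  also have "\<dots> = (M * norm (x, y))\<^sup>2"
    using M(1) by (simp add: norm_Pair x_def y_def algebra_simps power2_eq_square)
  finally have eq: "norm ((foguel ?T ^^ n) (x, y)) = M * norm (x, y)"
    using M(1) by (simp add: power2_eq_iff_nonneg)
  have "norm (x, y) \<noteq> 0"
    using v by (simp add: norm_Pair x_def sum_power2_eq_zero_iff)
  then have "M = norm ((foguel ?T ^^ n) (x, y)) / norm (x, y)"
    unfolding eq by simp
  also have "\<dots> \<le> onorm (foguel ?T ^^ n)"
    by (intro le_onorm bounded_linear_funpow bounded_linear_foguel T)
  finally show "(s + sqrt (s\<^sup>2 + 4)) / 2 \<le> onorm (foguel ?T ^^ n)"
    by (simp add: M_def)
qed

theorem corollary3:
  assumes nonzero: "\<exists>v :: 'e::complex_hilbert_space. v \<noteq> 0"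
    and separable: "separable_space (euclidean :: 'e topology)"
  shows "(\<forall>T :: 'e ell2 \<Rightarrow> 'e ell2. bounded_clinear T \<longrightarrow>
            (\<forall>n::nat. n \<ge> 1 \<longrightarrow>
              onorm (foguel T ^^ n)
                \<le> (real n * onorm T + sqrt ((real n)\<^sup>2 * (onorm T)\<^sup>2 + 4)) / 2)) \<and>
         (\<forall>n::nat. n \<ge> 1 \<longrightarrow>
            (\<exists>T :: 'e ell2 \<Rightarrow> 'e ell2. bounded_clinear T \<and>
              onorm (foguel T ^^ n)
                = (real n * onorm T + sqrt ((real n)\<^sup>2 * (onorm T)\<^sup>2 + 4)) / 2))"
proof (intro conjI allI impI)
  fix T :: "'e ell2 \<Rightarrow> 'e ell2" and n :: nat
  assume "bounded_clinear T"
  then have "bounded_linear T" by (rule bounded_clinear.axioms)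
  from onorm_foguel_funpow_le[OF this, of n]
  show "onorm (foguel T ^^ n)
      \<le> (real n * onorm T + sqrt ((real n)\<^sup>2 * (onorm T)\<^sup>2 + 4)) / 2"
    by (simp add: power_mult_distrib)
next
  fix n :: nat
  assume "n \<ge> 1"
  \<comment> \<open>The witness depends on \<open>n\<close>; as the flip has norm 1, the right-hand
    side is the bound with \<open>s = real n\<close>.\<close>
  then show "\<exists>T :: 'e ell2 \<Rightarrow> 'e ell2. bounded_clinear T \<and>
      onorm (foguel T ^^ n) = (real n * onorm T + sqrt ((real n)\<^sup>2 * (onorm T)\<^sup>2 + 4)) / 2"
    using bounded_clinear_flip_ell2 onorm_flip_ell2[OF nonzero] onorm_foguel_flip_funpow[OF nonzero]
    by (intro exI[of _ "flip_ell2 n"]) simp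
qed

end
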